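(* Let $k>0$ and let $f(x)=kx^{k-1}\exp(-x^k)$ for $x>0$ (and $f(x)=0$ for $x\le0$) be the Weibull density with shape parameter $k$. Let $g$ be a continuously differentiable probability density with support $(0,\infty)$ such that $$\lim_{x\to0}\frac{g(\lambda x)}{g(x)}=\lim_{x\to0}\frac{f(\lambda x)}{f(x)}\qquad\text{for all }\lambda>0 .$$ Then the statistic $$\hat\sigma^{(n)}(x_1,\dots,x_n)=\Bigl(n^{-1}\sum_{i=1}^n x_i^k\Bigr)^{-1/k}$$ is the maximum likelihood estimator of the scale parameter $\sigma$ in the scale family $\{\sigma g(\sigma x):\sigma>0\}$ for all samples $(x_1,\dots,x_n)\in(0,\infty)^n$ of all sample sizes $n\ge1$ if and only if $g=f$ on $(0,\infty)$.
   Context: A density has support $(0,\infty)$ if it is strictly positive on $(0,\infty)$ and zero elsewhere. Limits are for $x\to0$ with $x>0$. That $\hat\sigma^{(n)}$ is the MLE of the scale parameter for the family generated by $g$ at the sample $(x_1,\dots,x_n)$ means $$\prod_{i=1}^n \hat\sigma^{(n)} g(\hat\sigma^{(n)}x_i)\ \ge\ \prod_{i=1}^n \sigma g(\sigma x_i)\quad\text{for all }\sigma>0.$$ *)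

theory Defs
  imports "HOL-Analysis.Analysis"
begin

definition prob_density :: "(real \<Rightarrow> real) \<Rightarrow> bool" where
  "prob_density g \<longleftrightarrow>
     g \<in> borel_measurable borel \<and> (\<forall>x. 0 \<le> g x) \<and> (\<integral>\<^sup>+x. ennreal (g x) \<partial>lborel) = 1"

(* "Support" is meant pointwise, not as a topological closure. *)
definition has_support :: "(real \<Rightarrow> real) \<Rightarrow> real set \<Rightarrow> bool" where
  "has_support g S \<longleftrightarrow> (\<forall>x\<in>S. 0 < g x) \<and> (\<forall>x. x \<notin> S \<longrightarrow> g x = 0)"

definition weibull_density :: "real \<Rightarrow> real \<Rightarrow> real" where
  "weibull_density k x =
     (if 0 < x then k * x powr (k - 1) * exp (- (x powr k)) else 0)"

(* Samples of size n are functions on nat of which only the values at 1, ..., n matter. *)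
definition weibull_scale_stat :: "real \<Rightarrow> nat \<Rightarrow> (nat \<Rightarrow> real) \<Rightarrow> real" where
  "weibull_scale_stat k n x = ((\<Sum>i=1..n. x i powr k) / real n) powr (- 1 / k)"

(* s attains the maximal likelihood over the scale family; uniqueness of the
   maximiser is not required. *)
definition is_scale_MLE :: "(real \<Rightarrow> real) \<Rightarrow> nat \<Rightarrow> (nat \<Rightarrow> real) \<Rightarrow> real \<Rightarrow> bool" where
  "is_scale_MLE g n x s \<longleftrightarrow>
     (\<forall>\<sigma>>0. (\<Prod>i=1..n. s * g (s * x i)) \<ge> (\<Prod>i=1..n. \<sigma> * g (\<sigma> * x i)))"

end

theory Submission
  imports Defs
begin

text \<open>
  Rescaling a sample so that its \<open>k\<close>-th powers have mean \<open>1\<close> makes the maximum likelihood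
  estimate equal to \<open>1\<close>, so the score equation says that \<open>\<psi> t = 1 + y g'(y) / g(y)\<close>,
  \<open>y = t\<^bsup>1/k\<^esup>\<close>, sums to zero over every sample with mean \<open>1\<close>. Samples with only two distinct
  values, together with continuity, force \<open>\<psi> t = c (1 - t)\<close>. Integrating this differential
  equation gives \<open>g x = C x\<^bsup>c-1\<^esup> exp (- (c/k) x\<^bsup>k\<^esup>)\<close>; the behaviour at \<open>0\<close> forces
  \<open>c = k\<close>, and the normalisation forces \<open>C = k\<close>. The converse is the inequality
  \<open>w exp (- w) \<le> exp (- 1)\<close>.
\<close>

lemma continuous_on_eq_0_of_Rats:
  fixes G :: "real \<Rightarrow> real"
  assumes "open S" "continuous_on S G" "\<And>r. r \<in> S \<Longrightarrow> r \<in> \<rat> \<Longrightarrow> G r = 0" "x \<in> S"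
  shows "G x = 0"
proof (rule ccontr)
  assume "G x \<noteq> 0"
  let ?U = "S \<inter> G -` (- {0})"
  have "open ?U"
    using assms(1,2) by (intro continuous_open_preimage) auto
  moreover have "x \<in> ?U"
    using \<open>G x \<noteq> 0\<close> assms(4) by auto
  ultimately obtain e where "0 < e" "ball x e \<subseteq> ?U"
    by (meson openE)
  moreover obtain r where "r \<in> \<rat>" "x < r" "r < x + e"
    using Rats_dense_in_real[of x "x + e"] \<open>0 < e\<close> by auto
  ultimately have "r \<in> ?U"
    by (auto simp: dist_real_def subset_iff)
  then show False
    using assms(3) \<open>r \<in> \<rat>\<close> by auto
qed

text \<open>A sample taking two values \<open>a\<close> and \<open>b\<close> with multiplicities
  \<open>p\<close> and \<open>q\<close> links \<open>\<psi> a\<close> to \<open>\<psi> b\<close>.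
  Only the ratio \<open>p / q\<close> enters, so continuity extends the relation from rational to
  real ratios. Linking every point to \<open>1/2\<close> then leaves one free constant.\<close>

lemma mean_one_sum_zero_imp_linear:
  fixes \<psi> :: "real \<Rightarrow> real"
  assumes cont: "continuous_on {0<..} \<psi>"
    and sum0: "\<And>n t. 1 \<le> n \<Longrightarrow> (\<And>i. i \<in> {1..n} \<Longrightarrow> 0 < t i) \<Longrightarrow> (\<Sum>i=1..n. t i) = real n
      \<Longrightarrow> (\<Sum>i=1..n. \<psi> (t i)) = 0"
  obtains c where "\<And>t. 0 < t \<Longrightarrow> \<psi> t = c * (1 - t)"
proof -
  have two_point: "real p * \<psi> a + real q * \<psi> b = 0"
    if "0 < a" "0 < b" "0 < q" "real p * a + real q * b = real p + real q"
    for a b :: real and p q :: nat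
  proof -
    have split: "(\<Sum>i=1..p + q. f (if i \<le> p then a else b)) = real p * f a + real q * f b"
      for f :: "real \<Rightarrow> real"
    proof -
      have "{1..p + q} = {1..p} \<union> {p + 1..p + q}"
        by auto
      then have "(\<Sum>i=1..p + q. f (if i \<le> p then a else b))
          = (\<Sum>i=1..p. f (if i \<le> p then a else b)) + (\<Sum>i=p+1..p+q. f (if i \<le> p then a else b))"
        by (simp add: sum.union_disjoint)
      then show ?thesis
        by simp
    qed
    have "(\<Sum>i=1..p + q. \<psi> (if i \<le> p then a else b)) = 0"
      using that split[of "\<lambda>x. x"] by (intro sum0) auto
    then show ?thesis
      using split[of \<psi>] by simp
  qed
  \<comment> \<open>Here \<open>r\<close> plays the role of \<open>p / q\<close>; mean one forces
    the second value to be \<open>1 + (1 - a) * r\<close>. Since \<open>a < 1\<close>, this value is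
    positive for every \<open>r > 0\<close>, so the density argument runs on the whole
    half-line.\<close>
  have cross: "\<psi> a * r + \<psi> (1 + (1 - a) * r) = 0"
    if a: "0 < a" "a < 1" and r: "0 < r" for a r
  proof (rule continuous_on_eq_0_of_Rats[where S = "{0<..}" and G = "\<lambda>r. \<psi> a * r + \<psi> (1 + (1 - a) * r)"])
    show "continuous_on {0<..} (\<lambda>r. \<psi> a * r + \<psi> (1 + (1 - a) * r))"
      using a by (intro continuous_intros continuous_on_compose2[OF cont]) (auto intro!: add_pos_nonneg)
  next
    fix r :: real
    assume "r \<in> {0<..}" "r \<in> \<rat>"
    then obtain p q :: nat where pq: "q \<noteq> 0" "r = real p / real q"
      using Rats_abs_nat_div_natE[of r] by (metis abs_of_pos greaterThan_iff)
    have "0 < 1 + (1 - a) * r"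
      using a \<open>r \<in> {0<..}\<close> by (intro add_pos_nonneg) auto
    moreover have "real p * a + real q * (1 + (1 - a) * r) = real p + real q"
      using pq by (simp add: field_simps)
    ultimately have "real p * \<psi> a + real q * \<psi> (1 + (1 - a) * r) = 0"
      using a pq by (intro two_point) auto
    then have "real q * (\<psi> a * r + \<psi> (1 + (1 - a) * r)) = 0"
      using pq by (simp add: distrib_left mult.commute)
    then show "\<psi> a * r + \<psi> (1 + (1 - a) * r) = 0"
      using pq by simp
  qed (use r in auto)
  \<comment> \<open>The sample consisting of the single value 1: \<open>q = 1\<close> and
    \<open>p = 0\<close>, in the order in which the assumptions of \<open>two_point\<close> mention
    them.\<close>
  have one: "\<psi> 1 = 0"
    using two_point[of 1 1 1 0] by simp
  show ?thesis
  proof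
    fix t :: real
    assume "0 < t"
    then consider "t < 1" | "t = 1" | "1 < t"
      by linarith
    \<comment> \<open>The constant is read off at \<open>1/2\<close>, where \<open>1 - t\<close>
      equals \<open>1/2\<close>.\<close>
    then show "\<psi> t = (2 * \<psi> (1/2)) * (1 - t)"
    proof cases
      case 1
      \<comment> \<open>The ratios \<open>1 / (1 - t)\<close> and 2 give \<open>t\<close> and
        \<open>1/2\<close> the same partner value 2, so that \<open>\<psi> 2\<close> can be
        eliminated.\<close>
      have "\<psi> (1 + (1 - t) * (1 / (1 - t))) = \<psi> 2" "\<psi> (1 + (1 - 1/2) * 2) = \<psi> 2"
        using 1 by auto
      then have "\<psi> t / (1 - t) + \<psi> 2 = 0" "\<psi> (1/2) * 2 + \<psi> 2 = 0"
        using cross[of t "1 / (1 - t)"] cross[of "1/2" 2] 1 \<open>0 < t\<close> by auto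
      then have "\<psi> t = - \<psi> 2 * (1 - t)" "\<psi> 2 = - (2 * \<psi> (1/2))"
        using 1 by (simp_all add: field_simps)
      then show ?thesis
        by simp
    next
      case 3
      \<comment> \<open>A point above 1 is itself a partner of \<open>1/2\<close>, for the ratio
        \<open>2 * (t - 1)\<close>.\<close>
      have "1 + (1 - 1/2) * (2 * (t - 1)) = t"
        by (simp add: field_simps)
      then show ?thesis
        using cross[of "1/2" "2 * (t - 1)"] 3 by (simp add: algebra_simps)
    qed (use one in simp)
  qed
qed

text \<open>Fermat's rule for the log-likelihood: it has an interior maximum at
  \<open>\<sigma> = 1\<close>, and each summand is the derivative there of
  \<open>ln \<sigma> + ln (g (\<sigma> * x i))\<close>.\<close>

lemma scale_MLE_1_imp_score_zero:
  fixes g D :: "real \<Rightarrow> real"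
  assumes mle: "is_scale_MLE g n x 1"
    and x: "\<And>i. i \<in> {1..n} \<Longrightarrow> 0 < x i"
    and gpos: "\<And>y. 0 < y \<Longrightarrow> 0 < g y"
    and D: "\<And>y. 0 < y \<Longrightarrow> (g has_real_derivative D y) (at y)"
  shows "(\<Sum>i=1..n. 1 + x i * D (x i) / g (x i)) = 0"
proof (rule DERIV_local_max[where f = "\<lambda>\<sigma>. \<Sum>i=1..n. ln (\<sigma> * g (\<sigma> * x i))" and x = 1 and d = 1])
  show "((\<lambda>\<sigma>. \<Sum>i=1..n. ln (\<sigma> * g (\<sigma> * x i))) has_real_derivative
      (\<Sum>i=1..n. 1 + x i * D (x i) / g (x i))) (at 1)"
  proof (rule DERIV_sum)
    fix i
    assume "i \<in> {1..n}"
    then have "0 < x i" "0 < g (x i)"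
      using x gpos by auto
    have "((\<lambda>\<sigma>. g (\<sigma> * x i)) has_real_derivative D (1 * x i) * x i) (at 1)"
      by (rule DERIV_chain2[where f = g]) (use D \<open>0 < x i\<close> in \<open>auto intro!: derivative_eq_intros\<close>)
    then show "((\<lambda>\<sigma>. ln (\<sigma> * g (\<sigma> * x i))) has_real_derivative 1 + x i * D (x i) / g (x i)) (at 1)"
      using \<open>0 < g (x i)\<close> by (auto intro!: derivative_eq_intros simp: field_simps)
  qed
  \<comment> \<open>Radius 1 keeps \<open>\<sigma>\<close> positive, so that all likelihoods are
    positive and \<open>ln\<close> preserves their order.\<close>
  show "\<forall>\<sigma>. \<bar>1 - \<sigma>\<bar> < 1 \<longrightarrow>
      (\<Sum>i=1..n. ln (\<sigma> * g (\<sigma> * x i))) \<le> (\<Sum>i=1..n. ln (1 * g (1 * x i)))"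
  proof (intro allI impI)
    fix \<sigma> :: real
    assume "\<bar>1 - \<sigma>\<bar> < 1"
    then have "0 < \<sigma>"
      by linarith
    have pos: "0 < s * g (s * x i)" if "0 < s" "i \<in> {1..n}" for s i
      using that x gpos by simp
    have ln_prod: "ln (\<Prod>i=1..n. s * g (s * x i)) = (\<Sum>i=1..n. ln (s * g (s * x i)))"
      if "0 < s" for s
      by (intro ln_prod) (simp, use pos[OF that] in \<open>metis less_irrefl\<close>)
    have "(\<Prod>i=1..n. \<sigma> * g (\<sigma> * x i)) \<le> (\<Prod>i=1..n. 1 * g (1 * x i))"
      using mle \<open>0 < \<sigma>\<close> by (simp add: is_scale_MLE_def)
    moreover have "0 < (\<Prod>i=1..n. \<sigma> * g (\<sigma> * x i))"
      using pos[OF \<open>0 < \<sigma>\<close>] by (intro prod_pos) auto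
    ultimately have "ln (\<Prod>i=1..n. \<sigma> * g (\<sigma> * x i)) \<le> ln (\<Prod>i=1..n. 1 * g (1 * x i))"
      by (simp only: ln_le_cancel_iff less_le_trans)
    then show "(\<Sum>i=1..n. ln (\<sigma> * g (\<sigma> * x i))) \<le> (\<Sum>i=1..n. ln (1 * g (1 * x i)))"
      using \<open>0 < \<sigma>\<close> by (simp only: ln_prod zero_less_one)
  qed
qed simp

text \<open>Division by \<open>y\<close> turns the equation into
  \<open>(ln g)' = (c - 1) / y - c * y powr (k - 1)\<close>, which integrates explicitly;
  \<open>C\<close> is the exponential of the integration constant.\<close>

lemma log_derivative_imp_gamma_form:
  fixes g D :: "real \<Rightarrow> real"
  assumes k: "0 < k"
    and gpos: "\<And>y. 0 < y \<Longrightarrow> 0 < g y"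
    and D: "\<And>y. 0 < y \<Longrightarrow> (g has_real_derivative D y) (at y)"
    and ode: "\<And>y. 0 < y \<Longrightarrow> 1 + y * D y / g y = c * (1 - y powr k)"
  obtains C where "0 < C" "\<And>y. 0 < y \<Longrightarrow> g y = C * y powr (c - 1) * exp (- (c / k) * y powr k)"
proof -
  \<comment> \<open>The logarithm of the quotient of \<open>g\<close> by the claimed shape, hence
    expected to be constant.\<close>
  define H where "H y = ln (g y) - (c - 1) * ln y + c / k * y powr k" for y
  have "(H has_real_derivative 0) (at y)" if "0 < y" for y
  proof -
    have "D y / g y = (c * (1 - y powr k) - 1) / y"
      using ode[OF that] that by (simp add: field_simps)
    moreover have "y powr k = y * y powr (k - 1)"
      using that by (simp add: powr_diff)
    ultimately have "D y / g y - (c - 1) / y + c / k * (k * y powr (k - 1)) = 0"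
      using that k by (simp add: field_simps)
    moreover have "(H has_real_derivative D y / g y - (c - 1) / y + c / k * (k * y powr (k - 1))) (at y)"
      unfolding H_def using that gpos[OF that] D[OF that] k
      by (auto intro!: derivative_eq_intros)
    ultimately show ?thesis
      by simp
  qed
  then have "\<exists>m. \<forall>y\<in>{0<..}. H y = m"
    by (intro has_field_derivative_zero_constant convex_real_interval)
      (auto intro: has_field_derivative_at_within)
  then obtain m where m: "\<And>y. 0 < y \<Longrightarrow> H y = m"
    by auto
  show ?thesis
  proof
    fix y :: real
    assume y: "0 < y"
    then have "ln (g y) = m + (c - 1) * ln y + - (c / k) * y powr k"
      using m[of y] by (simp add: H_def)
    then have "g y = exp (m + (c - 1) * ln y + - (c / k) * y powr k)"
      using gpos[OF y] by (metis exp_ln)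
    then show "g y = exp m * y powr (c - 1) * exp (- (c / k) * y powr k)"
      using y by (simp only: exp_add powr_def) simp
  qed simp
qed

lemma tendsto_powr_at_right_0:
  fixes k :: real
  assumes "0 < k"
  shows "((\<lambda>x. x powr k) \<longlongrightarrow> 0) (at_right 0)"
  by (rule tendsto_zero_powrI[where b = k]) (use assms in \<open>auto simp: eventually_at_filter\<close>)

text \<open>The quotient equals \<open>l powr a * exp (- b * (l powr k - 1) * x powr k)\<close>, and
  its exponential factor tends to 1. The limit thus detects the exponent \<open>a\<close>; it serves
  for both \<open>g\<close> and the Weibull density.\<close>

lemma gamma_form_scale_limit:
  fixes g :: "real \<Rightarrow> real"
  assumes k: "0 < k" and C: "C \<noteq> 0" and l: "0 < l"
    and g: "\<And>y. 0 < y \<Longrightarrow> g y = C * y powr a * exp (- b * y powr k)"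
  shows "((\<lambda>x. g (l * x) / g x) \<longlongrightarrow> l powr a) (at_right 0)"
proof -
  have "((\<lambda>x. l powr a * exp (- b * (l powr k - 1) * x powr k)) \<longlongrightarrow>
      l powr a * exp (- b * (l powr k - 1) * 0)) (at_right 0)"
    by (intro tendsto_intros tendsto_powr_at_right_0 k)
  moreover have "\<forall>\<^sub>F x in at_right 0. l powr a * exp (- b * (l powr k - 1) * x powr k) = g (l * x) / g x"
    unfolding eventually_at_filter
  proof (intro always_eventually allI impI)
    fix x :: real
    assume "x \<in> {0<..}"
    then have x: "0 < x"
      by simp
    have "- b * (l * x) powr k = - b * (l powr k - 1) * x powr k + - b * x powr k"
      using x l by (simp add: powr_mult algebra_simps)
    then have "exp (- b * (l * x) powr k)
        = exp (- b * (l powr k - 1) * x powr k) * exp (- b * x powr k)"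
      by (simp only: exp_add)
    then show "l powr a * exp (- b * (l powr k - 1) * x powr k) = g (l * x) / g x"
      using x l C by (simp add: g powr_mult)
  qed
  ultimately show ?thesis
    by (auto elim: Lim_transform_eventually)
qed

lemma filterlim_powr_at_top:
  fixes k :: real
  assumes "0 < k"
  shows "filterlim (\<lambda>x. x powr k) at_top at_top"
proof (rule filterlim_mono_eventually)
  show "filterlim (\<lambda>x. exp (k * ln x)) at_top at_top"
    by (intro filterlim_compose[OF exp_at_top]
        filterlim_tendsto_pos_mult_at_top[OF tendsto_const assms ln_at_top])
  show "\<forall>\<^sub>F x in at_top. exp (k * ln x) = x powr k"
    using eventually_gt_at_top[of 0] by eventually_elim (simp add: powr_def)
qed simp_all

text \<open>The antiderivative \<open>- exp (- (x powr k))\<close> rises from -1 at 0 to 0 at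
  infinity.\<close>

lemma nn_integral_weibull_density:
  assumes k: "0 < k"
  shows "(\<integral>\<^sup>+x. ennreal (weibull_density k x) \<partial>lborel) = 1"
proof -
  let ?w = "\<lambda>x. k * x powr (k - 1) * exp (- (x powr k))"
  have deriv: "((\<lambda>x. - exp (- (x powr k))) has_real_derivative ?w x) (at x)" if "0 < ereal x" for x
    using that k by (auto intro!: derivative_eq_intros)
  have cont: "isCont ?w x" if "0 < ereal x" for x
    using that by (auto intro!: continuous_intros)
  have nonneg: "AE x in lborel. 0 < ereal x \<longrightarrow> ereal x < \<infinity> \<longrightarrow> 0 \<le> ?w x"
    using k by simp
  have "((\<lambda>x. - exp (- (x powr k))) \<longlongrightarrow> - exp (- 0)) (at_right 0)"
    by (intro tendsto_intros tendsto_powr_at_right_0 k)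
  then have lim_0: "(((\<lambda>x. - exp (- (x powr k))) \<circ> real_of_ereal) \<longlongrightarrow> - 1) (at_right 0)"
    by (simp add: zero_ereal_def ereal_tendsto_simps)
  have "((\<lambda>x. - exp (- (x powr k))) \<longlongrightarrow> - 0) at_top"
    by (intro tendsto_minus filterlim_compose[OF exp_at_bot]
        filterlim_compose[OF filterlim_uminus_at_bot_at_top] filterlim_powr_at_top k)
  then have lim_top: "(((\<lambda>x. - exp (- (x powr k))) \<circ> real_of_ereal) \<longlongrightarrow> 0) (at_left \<infinity>)"
    by (simp add: ereal_tendsto_simps)
  note FTC = interval_integral_FTC_nonneg[OF _ deriv cont nonneg lim_0 lim_top]
  have w: "weibull_density k x = indicator (einterval 0 \<infinity>) x *\<^sub>R ?w x" for x
    by (auto simp: weibull_density_def einterval_def indicator_def)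
  have "integrable lborel (weibull_density k)"
    using FTC(1) by (simp add: set_integrable_def w[abs_def])
  then have "(\<integral>\<^sup>+x. ennreal (weibull_density k x) \<partial>lborel) = ennreal (\<integral>x. weibull_density k x \<partial>lborel)"
    by (rule nn_integral_eq_integral) (use k in \<open>simp add: weibull_density_def\<close>)
  also have "(\<integral>x. weibull_density k x \<partial>lborel) = 1"
    using FTC(2) by (simp add: interval_lebesgue_integral_def set_lebesgue_integral_def w)
  finally show ?thesis
    by simp
qed

text \<open>The likelihood depends on \<open>\<sigma>\<close> only through
  \<open>u = \<sigma> powr k\<close>, as a nonnegative constant times
  \<open>u ^ n * exp (- (u * S))\<close>. This is maximal at \<open>u = n / S\<close>, which is the
  \<open>k\<close>-th power of the statistic.\<close>

lemma weibull_density_scale_MLE: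
  assumes k: "0 < k" and n: "1 \<le> n" and x: "\<And>i. i \<in> {1..n} \<Longrightarrow> 0 < x i"
    and g: "\<And>y. 0 < y \<Longrightarrow> g y = weibull_density k y"
  shows "is_scale_MLE g n x (weibull_scale_stat k n x)"
proof -
  define S where "S = (\<Sum>i=1..n. x i powr k)"
  define P where "P = (\<Prod>i=1..n. k * x i powr (k - 1))"
  define s where "s = weibull_scale_stat k n x"
  have "0 < S"
    unfolding S_def using n x by (intro sum_pos) (auto simp: less_imp_neq[THEN not_sym])
  have "0 \<le> P"
    unfolding P_def using k by (intro prod_nonneg) auto
  have likelihood: "(\<Prod>i=1..n. \<sigma> * g (\<sigma> * x i)) = P * ((\<sigma> powr k) ^ n * exp (- (\<sigma> powr k * S)))"
    if "0 < \<sigma>" for \<sigma>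
  proof -
    have "\<sigma> * g (\<sigma> * x i) = (k * x i powr (k - 1)) * (\<sigma> powr k * exp (- (\<sigma> powr k * x i powr k)))"
      if "i \<in> {1..n}" for i
      using \<open>0 < \<sigma>\<close> x[OF that] by (simp add: g weibull_density_def powr_mult powr_diff)
    then have "(\<Prod>i=1..n. \<sigma> * g (\<sigma> * x i))
        = (\<Prod>i=1..n. (k * x i powr (k - 1)) * (\<sigma> powr k * exp (- (\<sigma> powr k * x i powr k))))"
      by (intro prod.cong) auto
    also have "\<dots> = P * ((\<sigma> powr k) ^ n * exp (\<Sum>i=1..n. - (\<sigma> powr k * x i powr k)))"
      by (simp add: prod.distrib P_def exp_sum)
    also have "(\<Sum>i=1..n. - (\<sigma> powr k * x i powr k)) = - (\<sigma> powr k * S)"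
      by (simp add: S_def sum_negf sum_distrib_left)
    finally show ?thesis .
  qed
  have "s = (S / real n) powr (- 1 / k)"
    by (simp add: s_def weibull_scale_stat_def S_def)
  moreover have "- 1 / k * k = - 1"
    using k by simp
  ultimately have s: "0 < s" "s powr k = real n / S"
    using n \<open>0 < S\<close> by (simp_all only: powr_powr) (simp_all add: powr_minus_divide)
  have "u ^ n * exp (- (u * S)) \<le> (real n / S) ^ n * exp (- (real n / S * S))" if "0 < u" for u
  proof -
    \<comment> \<open>Normalised so that the candidate maximiser \<open>u = n / S\<close>
      corresponds to \<open>w = 1\<close>.\<close>
    define w where "w = u * S / real n"
    have "0 \<le> w"
      using that \<open>0 < S\<close> by (simp add: w_def)
    \<comment> \<open>The bound \<open>w \<le> exp (w - 1)\<close> is the tangent-line inequality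
      for \<open>exp\<close> at 0, taken at the point \<open>w - 1\<close>.\<close>
    have "w * exp (- w) \<le> exp (w - 1) * exp (- w)"
      using exp_ge_add_one_self[of "w - 1"] by (intro mult_right_mono) auto
    then have "w * exp (- w) \<le> exp (- 1)"
      by (simp flip: exp_add)
    then have "(w * exp (- w)) ^ n \<le> exp (- 1) ^ n"
      using \<open>0 \<le> w\<close> by (intro power_mono) auto
    then have "(real n / S) ^ n * (w * exp (- w)) ^ n \<le> (real n / S) ^ n * exp (- 1) ^ n"
      using \<open>0 < S\<close> by (intro mult_left_mono) auto
    moreover have "exp (- w) ^ n = exp (- (u * S))" "exp (- 1) ^ n = exp (- (real n / S * S))"
      using n \<open>0 < S\<close> by (simp_all add: w_def flip: exp_of_nat_mult)
    moreover have "(real n / S) ^ n * w ^ n = u ^ n"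
      using n \<open>0 < S\<close> by (simp add: w_def flip: power_mult_distrib)
    ultimately show ?thesis
      by (simp add: power_mult_distrib flip: mult.assoc)
  qed
  then have "(\<Prod>i=1..n. \<sigma> * g (\<sigma> * x i)) \<le> (\<Prod>i=1..n. s * g (s * x i))" if "0 < \<sigma>" for \<sigma>
    unfolding likelihood[OF that] likelihood[OF s(1)] s(2)
    using that \<open>0 \<le> P\<close> by (intro mult_left_mono) auto
  then show ?thesis
    by (simp add: is_scale_MLE_def s_def)
qed

theorem corollary7p2:
  fixes k :: real and g :: "real \<Rightarrow> real"
  assumes "0 < k"
    and "prob_density g"
    and "has_support g {0<..}"
    and "g C1_differentiable_on {0<..}"
    and "\<And>c::real. 0 < c \<Longrightarrow>
           \<exists>L. ((\<lambda>x. g (c * x) / g x) \<longlongrightarrow> L) (at_right 0) \<and>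
               ((\<lambda>x. weibull_density k (c * x) / weibull_density k x) \<longlongrightarrow> L) (at_right 0)"
  shows "(\<forall>n\<ge>1. \<forall>x. (\<forall>i\<in>{1..n}. 0 < x i) \<longrightarrow>
              is_scale_MLE g n x (weibull_scale_stat k n x))
         \<longleftrightarrow> (\<forall>x>0. g x = weibull_density k x)"
proof
  assume "\<forall>x>0. g x = weibull_density k x"
  then show "\<forall>n\<ge>1. \<forall>x. (\<forall>i\<in>{1..n}. 0 < x i) \<longrightarrow> is_scale_MLE g n x (weibull_scale_stat k n x)"
    using \<open>0 < k\<close> by (auto intro!: weibull_density_scale_MLE)
next
  assume mle: "\<forall>n\<ge>1. \<forall>x. (\<forall>i\<in>{1..n}. 0 < x i) \<longrightarrow>
    is_scale_MLE g n x (weibull_scale_stat k n x)"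
  have gpos: "0 < g y" if "0 < y" for y
    using assms(3) that by (simp add: has_support_def)
  obtain D where D: "\<And>y. 0 < y \<Longrightarrow> (g has_real_derivative D y) (at y)"
    and contD: "continuous_on {0<..} D"
    using assms(4)
    by (auto simp: C1_differentiable_on_def has_real_derivative_iff_has_vector_derivative)
  have contg: "continuous_on {0<..} g"
    using D by (intro DERIV_continuous_on) (auto intro: has_field_derivative_at_within)
  \<comment> \<open>The score at scale 1 of a single observation \<open>y\<close>.\<close>
  define \<phi> where "\<phi> y = 1 + y * D y / g y" for y
  have cont\<phi>: "continuous_on {0<..} \<phi>"
    unfolding \<phi>_def using gpos by (intro continuous_intros contD contg) (auto simp: less_le)
  obtain c where c: "\<And>t. 0 < t \<Longrightarrow> \<phi> (t powr (1 / k)) = c * (1 - t)"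
  proof (rule mean_one_sum_zero_imp_linear)
    show "continuous_on {0<..} (\<lambda>t. \<phi> (t powr (1 / k)))"
      by (rule continuous_on_compose2[OF cont\<phi>]) (auto intro!: continuous_intros)
  next
    fix n :: nat and t :: "nat \<Rightarrow> real"
    assume n: "1 \<le> n" and t: "\<And>i. i \<in> {1..n} \<Longrightarrow> 0 < t i" and sum_t: "(\<Sum>i=1..n. t i) = real n"
    \<comment> \<open>The \<open>k\<close>-th powers of this sample are the \<open>t i\<close>, of
      mean one, so the statistic takes the value 1.\<close>
    let ?x = "\<lambda>i. t i powr (1 / k)"
    have x: "0 < ?x i" if "i \<in> {1..n}" for i
      using t[OF that] by simp
    have "(\<Sum>i=1..n. ?x i powr k) = real n"
      unfolding sum_t[symmetric] using t \<open>0 < k\<close> by (intro sum.cong) (auto simp: powr_powr less_imp_le)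
    then have "weibull_scale_stat k n ?x = 1"
      using n by (simp add: weibull_scale_stat_def)
    then have "is_scale_MLE g n ?x 1"
      using mle n x by metis
    then show "(\<Sum>i=1..n. \<phi> (?x i)) = 0"
      unfolding \<phi>_def using x gpos D by (rule scale_MLE_1_imp_score_zero)
  qed (rule that)
  have "1 + y * D y / g y = c * (1 - y powr k)" if "0 < y" for y
    using c[of "y powr k"] that \<open>0 < k\<close> by (simp add: powr_powr \<phi>_def)
  then obtain C where "0 < C" and g: "\<And>y. 0 < y \<Longrightarrow> g y = C * y powr (c - 1) * exp (- (c / k) * y powr k)"
    using log_derivative_imp_gamma_form[OF \<open>0 < k\<close> gpos D] by blast
  \<comment> \<open>Scale factor 2: as a base different from 1, it lets equal powers be compared by
    their exponents.\<close>
  obtain L where "((\<lambda>x. g (2 * x) / g x) \<longlongrightarrow> L) (at_right 0)"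
    "((\<lambda>x. weibull_density k (2 * x) / weibull_density k x) \<longlongrightarrow> L) (at_right 0)"
    using assms(5)[of 2] by auto
  moreover have "((\<lambda>x. g (2 * x) / g x) \<longlongrightarrow> 2 powr (c - 1)) (at_right 0)"
    by (rule gamma_form_scale_limit[OF \<open>0 < k\<close> _ _ g]) (use \<open>0 < C\<close> in auto)
  moreover have "((\<lambda>x. weibull_density k (2 * x) / weibull_density k x) \<longlongrightarrow> 2 powr (k - 1)) (at_right 0)"
    by (rule gamma_form_scale_limit[where C = k and b = 1])
      (use \<open>0 < k\<close> in \<open>auto simp: weibull_density_def\<close>)
  ultimately have "(2::real) powr (c - 1) = 2 powr (k - 1)"
    by (metis tendsto_unique trivial_limit_at_right_real)
  then have "c = k"
    by (simp add: powr_inj)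
  \<comment> \<open>Stated for all \<open>y\<close>, since both sides vanish off the positive
    half-line, so that it can be integrated over the whole line. Both densities have total mass 1,
    which forces \<open>C / k = 1\<close>.\<close>
  have g_eq: "g y = C / k * weibull_density k y" for y
    using g[of y] \<open>0 < k\<close> \<open>c = k\<close> assms(3) by (auto simp: weibull_density_def has_support_def)
  have "weibull_density k \<in> borel_measurable borel"
    unfolding weibull_density_def[abs_def] by measurable
  then have "(\<integral>\<^sup>+x. ennreal (g x) \<partial>lborel) = ennreal (C / k) * (\<integral>\<^sup>+x. ennreal (weibull_density k x) \<partial>lborel)"
    using \<open>0 < C\<close> \<open>0 < k\<close> by (simp add: g_eq ennreal_mult' nn_integral_cmult del: times_divide_eq_left times_divide_eq_right)
  then have "ennreal (C / k) = 1"
    using assms(2) nn_integral_weibull_density[OF \<open>0 < k\<close>] by (simp add: prob_density_def)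
  then show "\<forall>x>0. g x = weibull_density k x"
    by (simp add: g_eq)
qed

end
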